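(* There is a constant $c>0$ such that for every integer $n\ge 0$, $$H_{V_n}\ge c\,n.$$
   Context: $\mathcal{H}=\{(x_1,x_2)\in\mathbb{Z}^2: x_2\ge 0\}$; for integers $n\ge0$, $L_n=\{(k,n):k\in\mathbb{Z}\}$ and $V_n=\{(0,k):0\le k\le n\}$. $(S_n)_{n\ge 0}$ is simple random walk on $\mathbb{Z}^2$, $P_z$ is its law when $S_0=z$, and for $A\subset\mathbb{Z}^2$, $\bar\tau_A=\min\{n\ge 0:S_n\in A\}$. For $B\subset\mathcal{H}$, $x\in B$ and an integer $N\geq 1$, $$H_{B,N}(x)=\sum_{z\in L_N\setminus B}P_z\big(S_{\bar\tau_{B\cup L_0}}=x\big),\qquad H_B(x)=\lim_{N\to\infty}H_{B,N}(x)$$ (the limit exists and is finite). For finite $B$, the (total) stationary harmonic measure of $B$ is $H_B=\sum_{x\in B}H_B(x)$. *)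

theory Defs
  imports "HOL-Probability.Probability"
begin

type_synonym site = "int \<times> int"

definition step_pmf :: "site pmf" where
  "step_pmf = pmf_of_set {(1, 0), (-1, 0), (0, 1), (0, -1)}"

definition steps :: "site stream measure" where
  "steps = stream_space (measure_pmf step_pmf)"

definition walk :: "site \<Rightarrow> site stream \<Rightarrow> nat \<Rightarrow> site" where
  "walk z \<omega> n = z + (\<Sum>i<n. \<omega> !! i)"

text \<open>Time 0 counts, and the value is \<open>\<infinity>\<close> (the infimum of the empty set) if the set is
  never visited.\<close>

definition hitting_time :: "site set \<Rightarrow> (nat \<Rightarrow> site) \<Rightarrow> enat" where
  "hitting_time A S = Inf {enat n |n. S n \<in> A}"

text \<open>The probability, for the walk started at \<open>z\<close>, that \<open>A\<close> is hit and that it is hit first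
  at \<open>x\<close>.\<close>

definition hitting_prob :: "site \<Rightarrow> site set \<Rightarrow> site \<Rightarrow> real" where
  "hitting_prob z A x =
     measure steps {\<omega> \<in> space steps. \<exists>t. hitting_time A (walk z \<omega>) = enat t \<and> walk z \<omega> t = x}"

definition level :: "nat \<Rightarrow> site set" where
  "level n = {(k, int n) |k. True}"

definition segment :: "nat \<Rightarrow> site set" where
  "segment n = {(0, k) |k. 0 \<le> k \<and> k \<le> int n}"

text \<open>The next three definitions are meant for \<open>B\<close> contained in the upper half plane
  \<open>{(x\<^sub>1, x\<^sub>2). x\<^sub>2 \<ge> 0}\<close>, \<open>x \<in> B\<close> and \<open>N \<ge> 1\<close>, the last one for finite \<open>B\<close>.\<close>

definition harmonic_measure_from :: "site set \<Rightarrow> nat \<Rightarrow> site \<Rightarrow> real" where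
  "harmonic_measure_from B N x =
     (\<Sum>\<^sub>\<infinity>z \<in> level N - B. hitting_prob z (B \<union> level 0) x)"

definition stationary_harmonic_measure :: "site set \<Rightarrow> site \<Rightarrow> real" where
  "stationary_harmonic_measure B x = lim (\<lambda>N. harmonic_measure_from B N x)"

definition total_harmonic_measure :: "site set \<Rightarrow> real" where
  "total_harmonic_measure B = (\<Sum>x\<in>B. stationary_harmonic_measure B x)"

end

theory Submission
  imports Defs
begin

text \<open>
  Let \<open>h (z)\<close> be the probability that the walk from \<open>z\<close> meets the segment when it first hits the segment
  or level 0, and \<open>G (m)\<close> the sum of \<open>h\<close> over level \<open>m\<close>. Summing the discrete Laplacian over a level shows
  that \<open>G\<close> is concave, because \<open>h\<close> is superharmonic above level 0, and affine, hence constant because it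
  is bounded, from level \<open>n\<close> on; the same argument for each point of the segment shows that the limit
  defining the stationary measure is attained at level \<open>n\<close>, so that the total measure is \<open>G (n)\<close>. A concave
  nonnegative sequence is nondecreasing, so \<open>G (n) \<ge> G (m)\<close> for \<open>m = n div 2\<close>. Finally, by the maximum
  principle, \<open>m\<^sup>2 h\<close> dominates the product of the positive parts of \<open>y - \<bar>x\<bar>\<close> and \<open>2 m - \<bar>x\<bar> - y\<close>, which is
  harmonic off the axis where it is positive, and this product sums to about \<open>2 m\<^sup>3 / 3\<close> over level \<open>m\<close>.
\<close>

section \<open>First hitting times and measurability of the walk\<close>

text \<open>A nonempty set of extended naturals attains its infimum, and the empty set has infimum
  \<infinity>. All later arguments use this first-visit form in place of \<open>Inf\<close>.\<close>

lemma hitting_time_eq_enat_iff: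
  "hitting_time A S = enat t \<longleftrightarrow> S t \<in> A \<and> (\<forall>s<t. S s \<notin> A)"
proof
  assume eq: "hitting_time A S = enat t"
  let ?X = "{enat n |n. S n \<in> A}"
  have "?X \<noteq> {}"
    using eq by (auto simp: hitting_time_def Inf_enat_def split: if_splits)
  then have "Inf ?X \<in> ?X"
    unfolding Inf_enat_def by (auto intro: LeastI)
  with eq have "S t \<in> A" by (auto simp: hitting_time_def)
  moreover have "S s \<notin> A" if "s < t" for s
  proof
    assume "S s \<in> A"
    then have "hitting_time A S \<le> enat s"
      unfolding hitting_time_def by (intro Inf_lower) auto
    with eq that show False by simp
  qed
  ultimately show "S t \<in> A \<and> (\<forall>s<t. S s \<notin> A)" by blast
next
  assume *: "S t \<in> A \<and> (\<forall>s<t. S s \<notin> A)"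
  show "hitting_time A S = enat t"
    unfolding hitting_time_def
  proof (rule antisym)
    show "Inf {enat n |n. S n \<in> A} \<le> enat t"
      using * by (intro Inf_lower) auto
    show "enat t \<le> Inf {enat n |n. S n \<in> A}"
      using * by (intro Inf_greatest) (auto simp: not_less[symmetric])
  qed
qed

interpretation steps: prob_space steps
  unfolding steps_def by (intro prob_space.prob_space_stream_space measure_pmf.prob_space_axioms)

lemma space_steps [simp]: "space steps = UNIV"
  by (simp add: steps_def space_stream_space)

lemma measurable_walk [measurable]: "(\<lambda>\<omega>. walk z \<omega> n) \<in> measurable steps (count_space UNIV)"
proof (induction n)
  case 0
  then show ?case by (simp add: walk_def)
next
  case (Suc n)
  have "(\<lambda>\<omega>. y + \<omega> !! n) \<in> measurable steps (count_space UNIV)" for y :: site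
    unfolding steps_def
    by (rule measurable_compose[where N = "measure_pmf step_pmf"]) auto
  from measurable_compose_countable[where f = "\<lambda>y \<omega>. y + \<omega> !! n", OF this Suc]
  show ?case by (simp add: walk_def add.assoc)
qed

section \<open>First-step analysis of hitting probabilities\<close>

text \<open>Truncating at time \<open>n\<close> allows induction on the number of steps;
  \<open>n\<close> tending to infinity recovers \<open>hitting_prob\<close>.\<close>

definition hitting_prob_within :: "nat \<Rightarrow> site \<Rightarrow> site set \<Rightarrow> site \<Rightarrow> real" where
  "hitting_prob_within n z A x =
     measure steps {\<omega> \<in> space steps. \<exists>t\<le>n. hitting_time A (walk z \<omega>) = enat t \<and> walk z \<omega> t = x}"

lemma walk_0 [simp]: "walk z \<omega> 0 = z"
  by (simp add: walk_def)

lemma walk_Stream_Suc [simp]: "walk z (a ## \<omega>) (Suc n) = walk (z + a) \<omega> n"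
  unfolding walk_def sum.lessThan_Suc_shift by (simp add: add.assoc)

text \<open>Conditioning on the first step: the stream splits into a uniform head and an independent
  tail with the same law. The factor 4 clears the uniform weight.\<close>

lemma measure_steps_first_step:
  assumes "E \<in> sets steps"
  shows "4 * measure steps E = (\<Sum>a\<in>{(1, 0), (-1, 0), (0, 1), (0, -1)}. measure steps {\<omega>. a ## \<omega> \<in> E})"
proof -
  let ?A = "{(1, 0), (-1, 0), (0, 1), (0, -1)} :: site set"
  let ?g = "\<lambda>a. measure steps {\<omega>. a ## \<omega> \<in> E}"
  have set_step: "set_pmf step_pmf = ?A"
    by (simp add: step_pmf_def)
  have "ennreal (measure steps E) = (\<integral>\<^sup>+a. ennreal (?g a) \<partial>measure_pmf step_pmf)"
    using prob_space.emeasure_stream_space[OF measure_pmf.prob_space_axioms, of E step_pmf] assms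
    by (simp add: steps_def space_stream_space flip: steps.emeasure_eq_measure[unfolded steps_def])
  also have "\<dots> = ennreal (\<integral>a. ?g a \<partial>measure_pmf step_pmf)"
    by (intro nn_integral_eq_integral integrable_measure_pmf_finite) (auto simp: set_step)
  also have "(\<integral>a. ?g a \<partial>measure_pmf step_pmf) = sum ?g ?A / 4"
    unfolding step_pmf_def by (subst integral_pmf_of_set) auto
  finally have "measure steps E = sum ?g ?A / 4"
    by (subst (asm) ennreal_inj) (auto intro!: sum_nonneg divide_nonneg_nonneg)
  then show ?thesis by simp
qed

lemma hitting_time_start: "z \<in> A \<Longrightarrow> hitting_time A (walk z \<omega>) = enat t \<longleftrightarrow> t = 0"
  unfolding hitting_time_eq_enat_iff by (metis gr0I not_less0 walk_0)

text \<open>Time 0 counts as a visit, so only for a start outside \<open>A\<close> does deleting the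
  first step leave the hitting point unchanged and lower the hitting time by one.\<close>

lemma hitting_time_Stream:
  assumes "z \<notin> A"
  shows "hitting_time A (walk z (a ## \<omega>)) = enat t \<and> walk z (a ## \<omega>) t = x \<longleftrightarrow>
    (\<exists>s. t = Suc s \<and> hitting_time A (walk (z + a) \<omega>) = enat s \<and> walk (z + a) \<omega> s = x)"
  using assms unfolding hitting_time_eq_enat_iff
  by (cases t) (auto simp: All_less_Suc2)

lemma sets_first_hit [measurable]:
  "{\<omega> \<in> space steps. hitting_time A (walk z \<omega>) = enat t \<and> walk z \<omega> t = x} \<in> sets steps"
  unfolding hitting_time_eq_enat_iff by measurable

lemma hitting_prob_start: "z \<in> A \<Longrightarrow> hitting_prob z A x = of_bool (z = x)"
  using steps.prob_space by (auto simp: hitting_prob_def hitting_time_start)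

lemma hitting_prob_within_start: "z \<in> A \<Longrightarrow> hitting_prob_within n z A x = of_bool (z = x)"
  using steps.prob_space by (auto simp: hitting_prob_within_def hitting_time_start)

lemma hitting_prob_within_0: "z \<notin> A \<Longrightarrow> hitting_prob_within 0 z A x = 0"
  by (simp add: hitting_prob_within_def hitting_time_eq_enat_iff)

lemma hitting_prob_step:
  assumes "z \<notin> A"
  shows "4 * hitting_prob z A x = (\<Sum>a\<in>{(1, 0), (-1, 0), (0, 1), (0, -1)}. hitting_prob (z + a) A x)"
proof -
  have "{\<omega> \<in> space steps. \<exists>t. hitting_time A (walk z \<omega>) = enat t \<and> walk z \<omega> t = x} \<in> sets steps"
    by measurable
  from measure_steps_first_step[OF this] show ?thesis
    by (simp only: hitting_prob_def mem_Collect_eq space_steps UNIV_I simp_thms hitting_time_Stream[OF assms])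
      (simp del: sum.insert)
qed

lemma hitting_prob_within_Suc:
  assumes "z \<notin> A"
  shows "4 * hitting_prob_within (Suc n) z A x =
    (\<Sum>a\<in>{(1, 0), (-1, 0), (0, 1), (0, -1)}. hitting_prob_within n (z + a) A x)"
proof -
  have "{\<omega> \<in> space steps. \<exists>t\<le>Suc n. hitting_time A (walk z \<omega>) = enat t \<and> walk z \<omega> t = x} \<in> sets steps"
    by measurable
  from measure_steps_first_step[OF this] show ?thesis
    by (simp only: hitting_prob_within_def mem_Collect_eq space_steps UNIV_I simp_thms hitting_time_Stream[OF assms])
      (auto intro!: sum.cong arg_cong[where f = "measure steps"] simp del: sum.insert)
qed

lemma LIMSEQ_hitting_prob_within: "(\<lambda>n. hitting_prob_within n z A x) \<longlonglongrightarrow> hitting_prob z A x"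
proof -
  let ?E = "\<lambda>n. {\<omega> \<in> space steps. \<exists>t\<le>n. hitting_time A (walk z \<omega>) = enat t \<and> walk z \<omega> t = x}"
  have "range ?E \<subseteq> sets steps"
    by (auto simp del: space_steps)
  moreover have "incseq ?E"
    by (auto simp: incseq_def intro: le_trans)
  ultimately have "(\<lambda>n. measure steps (?E n)) \<longlonglongrightarrow> measure steps (\<Union>n. ?E n)"
    by (rule steps.finite_Lim_measure_incseq)
  also have "(\<Union>n. ?E n) = {\<omega> \<in> space steps. \<exists>t. hitting_time A (walk z \<omega>) = enat t \<and> walk z \<omega> t = x}"
    by auto
  finally show ?thesis
    by (simp add: hitting_prob_within_def hitting_prob_def)
qed

lemma hitting_prob_nonneg: "0 \<le> hitting_prob z A x"
  by (simp add: hitting_prob_def)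

lemma sum_hitting_prob_le_1:
  assumes "finite B"
  shows "(\<Sum>x\<in>B. hitting_prob z A x) \<le> 1"
proof -
  let ?E = "\<lambda>x. {\<omega> \<in> space steps. \<exists>t. hitting_time A (walk z \<omega>) = enat t \<and> walk z \<omega> t = x}"
  have "?E ` B \<subseteq> sets steps"
    by (auto simp del: space_steps)
  moreover have "disjoint_family_on ?E B"
    by (auto simp: disjoint_family_on_def)
  ultimately have "(\<Sum>x\<in>B. measure steps (?E x)) = measure steps (\<Union>x\<in>B. ?E x)"
    using assms by (intro steps.finite_measure_finite_Union[symmetric])
  also have "\<dots> \<le> 1" by simp
  finally show ?thesis by (simp add: hitting_prob_def)
qed

section \<open>Bounds for row sums of hitting probabilities\<close>

lemma sum_of_bool_level_le: "finite K \<Longrightarrow> (\<Sum>k\<in>K. of_bool ((k, int m) = (i, int j)) :: real) \<le> of_bool (m = j)"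
  by (cases "m = j") (auto simp: of_bool_def sum.delta)

lemma sum_shift_int: "(\<Sum>k\<in>K. f (k + c)) = (\<Sum>k\<in>(\<lambda>k. k + c) ` K. f k)" for c :: int
  by (subst sum.reindex) auto

text \<open>The bound is the Green function of the vertical coordinate (a lazy walk on the naturals killed
  at 0), plus 1 to cover a target on level 0. It holds for all finite \<open>K\<close>, which makes the induction
  on the number of steps free of summability questions.\<close>

lemma sum_hitting_prob_within_le:
  assumes A: "level 0 \<subseteq> A" and "finite K"
  shows "(\<Sum>k\<in>K. hitting_prob_within n (k, int m) A (i, int j)) \<le> 1 + 4 * real (min m j)"
  using \<open>finite K\<close>
proof (induction n arbitrary: K m)
  case 0
  have "(\<Sum>k\<in>K. hitting_prob_within 0 (k, int m) A (i, int j)) \<le> (\<Sum>k\<in>K. of_bool ((k, int m) = (i, int j)))"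
  proof (rule sum_mono)
    fix k
    show "hitting_prob_within 0 (k, int m) A (i, int j) \<le> of_bool ((k, int m) = (i, int j))"
      by (cases "(k, int m) \<in> A") (simp_all add: hitting_prob_within_start hitting_prob_within_0)
  qed
  also have "\<dots> \<le> of_bool (m = j)"
    by (rule sum_of_bool_level_le) fact
  also have "\<dots> \<le> 1 + 4 * real (min m j)" by simp
  finally show ?case .
next
  case (Suc n)
  let ?q = "\<lambda>z. hitting_prob_within n z A (i, int j)"
  let ?\<delta> = "\<lambda>m k. of_bool ((k, int m) = (i, int j)) :: real"
  show ?case
  proof (cases m)
    case 0
    have "hitting_prob_within (Suc n) (k, int m) A (i, int j) = ?\<delta> m k" for k
      using A 0 by (intro hitting_prob_within_start) (auto simp: level_def)
    then have "(\<Sum>k\<in>K. hitting_prob_within (Suc n) (k, int m) A (i, int j)) \<le> of_bool (m = j)"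
      using sum_of_bool_level_le[OF Suc.prems, of m i j] by simp
    also have "\<dots> \<le> 1 + 4 * real (min m j)" by simp
    finally show ?thesis .
  next
    case m: (Suc m')
    \<comment> \<open>One inequality serves both cases: in \<open>A\<close> the value is the point
      mass, outside \<open>A\<close> it is the average over the four neighbours.\<close>
    have step: "hitting_prob_within (Suc n) (k, int m) A (i, int j) \<le>
        ?\<delta> m k + (?q (k + 1, int m) + ?q (k + -1, int m) + ?q (k, int (Suc m)) + ?q (k, int m')) / 4" for k
    proof (cases "(k, int m) \<in> A")
      case True
      have "0 \<le> ?q z" for z by (simp add: hitting_prob_within_def)
      then show ?thesis
        by (simp only: hitting_prob_within_start[OF True]) simp
    next
      case False
      from hitting_prob_within_Suc[OF False, of n "(i, int j)"]
      have "4 * hitting_prob_within (Suc n) (k, int m) A (i, int j) =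
          ?q (k + 1, int m) + ?q (k + -1, int m) + ?q (k, int (Suc m)) + ?q (k, int m')"
        by (simp add: m add.commute)
      moreover have "0 \<le> ?\<delta> m k"
        by (simp del: prod.inject)
      moreover have "p \<le> d + s / 4" if "4 * p = s" "0 \<le> d" for p d s :: real
        using that by simp
      ultimately show ?thesis
        by blast
    qed
    have "(\<Sum>k\<in>K. hitting_prob_within (Suc n) (k, int m) A (i, int j)) \<le>
        (\<Sum>k\<in>K. ?\<delta> m k + (?q (k + 1, int m) + ?q (k + -1, int m) + ?q (k, int (Suc m)) + ?q (k, int m')) / 4)"
      by (intro sum_mono step)
    also have "\<dots> = (\<Sum>k\<in>K. ?\<delta> m k) + ((\<Sum>k\<in>K. ?q (k + 1, int m)) + (\<Sum>k\<in>K. ?q (k + -1, int m))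
        + (\<Sum>k\<in>K. ?q (k, int (Suc m))) + (\<Sum>k\<in>K. ?q (k, int m'))) / 4"
      by (simp only: sum.distrib flip: sum_divide_distrib)
    also have "\<dots> \<le> of_bool (m = j) + ((1 + 4 * real (min m j)) + (1 + 4 * real (min m j))
        + (1 + 4 * real (min (Suc m) j)) + (1 + 4 * real (min m' j))) / 4"
      unfolding sum_shift_int[where f = "\<lambda>k. ?q (k, int m)"]
      using Suc.prems by (intro add_mono divide_right_mono Suc.IH sum_of_bool_level_le) auto
    \<comment> \<open>The kink of \<open>min m j\<close> at \<open>m = j\<close> lowers the average
      of the bound by exactly 1, which pays for the point mass there.\<close>
    also have "\<dots> \<le> 1 + 4 * real (min m j)"
      using m by (auto simp: min_def of_bool_def)
    finally show ?thesis .
  qed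
qed

text \<open>The finite bound is uniform in the number of steps and in \<open>K\<close>: it passes to
  the limit in time, and then bounds all finite partial sums of nonnegative terms.\<close>

lemma
  assumes A: "level 0 \<subseteq> A"
  shows summable_on_hitting_prob_row: "(\<lambda>k. hitting_prob (k, int m) A (i, int j)) summable_on UNIV"
    and infsum_hitting_prob_row_le: "(\<Sum>\<^sub>\<infinity>k. hitting_prob (k, int m) A (i, int j)) \<le> 1 + 4 * real (min m j)"
proof -
  have le: "(\<Sum>k\<in>K. hitting_prob (k, int m) A (i, int j)) \<le> 1 + 4 * real (min m j)" if "finite K" for K
    by (rule LIMSEQ_le_const2[OF tendsto_sum[OF LIMSEQ_hitting_prob_within]])
      (use sum_hitting_prob_within_le[OF A that] in blast)
  show "(\<lambda>k. hitting_prob (k, int m) A (i, int j)) summable_on UNIV"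
    by (rule nonneg_bdd_above_summable_on) (use le hitting_prob_nonneg in \<open>auto intro!: bdd_aboveI2\<close>)
  then show "(\<Sum>\<^sub>\<infinity>k. hitting_prob (k, int m) A (i, int j)) \<le> 1 + 4 * real (min m j)"
    by (rule infsum_le_finite_sums) (rule le)
qed

section \<open>Row sums of the discrete Laplacian; concave and affine sequences\<close>

lemma
  fixes f :: "int \<Rightarrow> 'a :: {comm_monoid_add, t2_space}"
  shows summable_on_shift_int: "(\<lambda>k. f (k + c)) summable_on UNIV \<longleftrightarrow> f summable_on UNIV"
    and infsum_shift_int: "(\<Sum>\<^sub>\<infinity>k. f (k + c)) = (\<Sum>\<^sub>\<infinity>k. f k)"
proof -
  have "bij (\<lambda>k::int. k + c)"
    by (rule bij_betw_byWitness[where f' = "\<lambda>k. k - c"]) auto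
  then show "(\<lambda>k. f (k + c)) summable_on UNIV \<longleftrightarrow> f summable_on UNIV"
    and "(\<Sum>\<^sub>\<infinity>k. f (k + c)) = (\<Sum>\<^sub>\<infinity>k. f k)"
    by (rule summable_on_reindex_bij_betw, rule infsum_reindex_bij_betw)
qed

definition neighbour_sum :: "(site \<Rightarrow> real) \<Rightarrow> int \<Rightarrow> int \<Rightarrow> real" where
  "neighbour_sum f x y = f (x + 1, y) + f (x + -1, y) + f (x, y + 1) + f (x, y + -1)"

lemma neighbour_sum_hitting_prob:
  "(x, y) \<notin> A \<Longrightarrow> neighbour_sum (\<lambda>z. hitting_prob z A w) x y = 4 * hitting_prob (x, y) A w"
  by (simp add: hitting_prob_step neighbour_sum_def)

text \<open>Horizontal neighbours are translates within the row and contribute the same row sum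
  twice. Summing the Laplacian over a row thus leaves the second difference of the row sums in the
  height.\<close>

lemma has_sum_neighbour_sum:
  assumes "\<And>m. (\<lambda>k. f (k, int m)) summable_on UNIV"
  shows "((\<lambda>k. neighbour_sum f k (int (Suc m))) has_sum
    2 * (\<Sum>\<^sub>\<infinity>k. f (k, int (Suc m))) + (\<Sum>\<^sub>\<infinity>k. f (k, int (Suc (Suc m)))) + (\<Sum>\<^sub>\<infinity>k. f (k, int m))) UNIV"
proof -
  have row: "((\<lambda>k. f (k, int m)) has_sum (\<Sum>\<^sub>\<infinity>k. f (k, int m))) UNIV" for m
    using assms by (rule has_sum_infsum)
  have shift: "((\<lambda>k. f (k + c, int m)) has_sum (\<Sum>\<^sub>\<infinity>k. f (k, int m))) UNIV" for c m
    using assms[of m] infsum_shift_int[of "\<lambda>k. f (k, int m)" c] summable_on_shift_int[of "\<lambda>k. f (k, int m)" c]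
    by (metis has_sum_infsum)
  show ?thesis
    using has_sum_add[OF has_sum_add[OF has_sum_add[OF shift[of 1 "Suc m"] shift[of "-1" "Suc m"]] row[of "Suc (Suc m)"]] row[of m]]
    by (simp add: neighbour_sum_def algebra_simps)
qed

text \<open>After one negative increment, concavity keeps every later increment at least as
  negative, which drives the sequence below 0.\<close>

lemma concave_nonneg_imp_mono:
  fixes f :: "nat \<Rightarrow> real"
  assumes concave: "\<And>m. f m + f (Suc (Suc m)) \<le> 2 * f (Suc m)" and nonneg: "\<And>m. 0 \<le> f m"
  shows "mono f"
proof (rule mono_iff_le_Suc[THEN iffD2], intro allI, rule ccontr)
  fix m
  assume "\<not> f m \<le> f (Suc m)"
  then have d: "0 < f m - f (Suc m)" by simp
  have decr: "f (Suc m + i) - f (m + i) \<le> f (Suc m) - f m" for i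
  proof (induction i)
    case (Suc i)
    then show ?case using concave[of "m + i"] by simp
  qed simp
  have "f (m + i) \<le> f m - real i * (f m - f (Suc m))" for i
  proof (induction i)
    case (Suc i)
    then show ?case using decr[of i] by (simp add: algebra_simps)
  qed simp
  moreover obtain i where "f m < real i * (f m - f (Suc m))"
    using reals_Archimedean3[OF d] by blast
  ultimately show False
    using nonneg[of "m + i"] by (smt (verit))
qed

text \<open>Both \<open>f\<close> and \<open>C - f\<close> are concave and nonnegative, hence
  nondecreasing.\<close>

lemma affine_bounded_imp_const:
  fixes f :: "nat \<Rightarrow> real"
  assumes affine: "\<And>m. f m + f (Suc (Suc m)) = 2 * f (Suc m)"
    and "\<And>m. 0 \<le> f m" and "\<And>m. f m \<le> C"
  shows "f m = f 0"
proof (rule antisym)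
  have "mono (\<lambda>m. C - f m)"
    using assms by (intro concave_nonneg_imp_mono) (auto simp: algebra_simps intro: eq_refl)
  from monoD[OF this, of 0 m] show "f m \<le> f 0" by simp
  have "mono f"
    using assms by (intro concave_nonneg_imp_mono) auto
  from monoD[OF this, of 0 m] show "f 0 \<le> f m" by simp
qed

section \<open>The comparison function and the maximum principle\<close>

text \<open>Where both factors are positive, the product is \<open>y (2 m - y) - \<bar>x\<bar> (2 m - \<bar>x\<bar>)\<close>.\<close>

definition tent :: "int \<Rightarrow> site \<Rightarrow> int" where
  "tent m = (\<lambda>(x, y). max 0 (y - \<bar>x\<bar>) * max 0 (2 * m - \<bar>x\<bar> - y))"

lemma tent_pos_iff: "0 < tent m (x, y) \<longleftrightarrow> \<bar>x\<bar> < y \<and> y < 2 * m - \<bar>x\<bar>"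
  by (auto simp: tent_def zero_less_mult_iff)

text \<open>Off the axis \<open>\<bar>x\<bar>\<close> is linear across the neighbours, so the second
  differences -2 in \<open>y\<close> and +2 in \<open>x\<close> cancel.\<close>

lemma neighbour_sum_tent:
  assumes "x \<noteq> 0" "0 < tent m (x, y)"
  shows "neighbour_sum (\<lambda>z. real_of_int (tent m z)) x y = 4 * tent m (x, y)"
proof -
  let ?p = "\<lambda>x y. (y - \<bar>x\<bar>) * (2 * m - \<bar>x\<bar> - y)"
  have xy: "\<bar>x\<bar> + 1 \<le> y" "y + 1 \<le> 2 * m - \<bar>x\<bar>"
    using assms(2) by (auto simp: tent_pos_iff)
  have "tent m (x', y') = ?p x' y'" if "\<bar>x'\<bar> \<le> y'" "y' \<le> 2 * m - \<bar>x'\<bar>" for x' y'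
    using that by (simp add: tent_def)
  with xy have "tent m (x + 1, y) = ?p (x + 1) y" "tent m (x + -1, y) = ?p (x + -1) y"
    "tent m (x, y + 1) = ?p x (y + 1)" "tent m (x, y + -1) = ?p x (y + -1)" "tent m (x, y) = ?p x y"
    by simp_all
  moreover have "?p (x + 1) y + ?p (x + -1) y + ?p x (y + 1) + ?p x (y + -1) = 4 * ?p x y"
  proof (cases "0 < x")
    case True
    then have "\<bar>x + 1\<bar> = x + 1" "\<bar>x + -1\<bar> = x - 1" "\<bar>x\<bar> = x" by auto
    then show ?thesis by (simp only:) (simp add: algebra_simps)
  next
    case False
    with assms(1) have "\<bar>x + 1\<bar> = - x - 1" "\<bar>x + -1\<bar> = - x + 1" "\<bar>x\<bar> = - x" by auto
    then show ?thesis by (simp only:) (simp add: algebra_simps)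
  qed
  ultimately show ?thesis
    unfolding neighbour_sum_def by (simp only: flip: of_int_add)
qed

text \<open>Where \<open>tent m - h\<close> is positive, \<open>tent m\<close> is positive and the
  axis is excluded, so the difference is subharmonic there. As \<open>tent m\<close> is positive at
  only finitely many sites, a positive value would entail a positive maximum.\<close>

lemma tent_le_superharmonic:
  fixes h :: "site \<Rightarrow> real"
  assumes nonneg: "\<And>z. 0 \<le> h z"
    and axis: "\<And>y. 0 < y \<Longrightarrow> y < 2 * m \<Longrightarrow> tent m (0, y) \<le> h (0, y)"
    and super: "\<And>x y. x \<noteq> 0 \<Longrightarrow> 0 < y \<Longrightarrow> neighbour_sum h x y \<le> 4 * h (x, y)"
  shows "tent m z \<le> h z"
proof (rule ccontr)
  assume "\<not> tent m z \<le> h z"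
  define D where "D z = tent m z - h z" for z
  define T where "T = {z. 0 < D z}"
  have "0 < tent m v" if "v \<in> T" for v
    using that nonneg[of v] by (simp add: T_def D_def)
  then have "T \<subseteq> {-\<bar>2 * m\<bar>..\<bar>2 * m\<bar>} \<times> {0..\<bar>2 * m\<bar>}"
    by (fastforce simp: tent_pos_iff)
  then have fin: "finite T"
    by (rule finite_subset) simp
  have "z \<in> T"
    using \<open>\<not> tent m z \<le> h z\<close> by (simp add: T_def D_def)
  with fin obtain w where "w \<in> T" "D w = Max (D ` T)"
    by (metis empty_iff obtains_MAX)
  with fin have w: "w \<in> T" "\<And>v. v \<in> T \<Longrightarrow> D v \<le> D w"
    by (blast, metis Max_ge finite_imageI imageI)
  \<comment> \<open>A topmost point among the maximisers of \<open>D\<close> has an upper neighbour with a strictly smaller value.\<close>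
  define M where "M = {v \<in> T. D v = D w}"
  have "finite M"
    using fin by (simp add: M_def)
  moreover have "w \<in> M"
    using w(1) by (simp add: M_def)
  ultimately obtain v where "v \<in> M" "snd v = Max (snd ` M)"
    by (metis empty_iff obtains_MAX)
  with \<open>finite M\<close> have v: "v \<in> M" "\<And>u. u \<in> M \<Longrightarrow> snd u \<le> snd v"
    by (blast, metis Max_ge finite_imageI imageI)
  obtain x y where xy: "v = (x, y)" by (cases v)
  have le: "D u \<le> D v" for u
    using w v(1) by (cases "u \<in> T") (auto simp: M_def T_def)
  have Dv: "0 < D (x, y)"
    using v(1) by (auto simp: M_def T_def xy)
  with nonneg[of "(x, y)"] have pos: "0 < tent m (x, y)"
    by (simp add: D_def)
  have "x \<noteq> 0"
    using axis[of y] Dv pos by (auto simp: D_def tent_pos_iff)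
  moreover have "0 < y"
    using pos by (auto simp: tent_pos_iff)
  ultimately have "4 * D (x, y) \<le> neighbour_sum D x y"
    using super neighbour_sum_tent[OF _ pos] by (force simp: D_def neighbour_sum_def)
  moreover have "D (x, y + 1) < D (x, y)"
  proof (rule ccontr)
    assume "\<not> D (x, y + 1) < D (x, y)"
    with le[of "(x, y + 1)"] have "D (x, y + 1) = D (x, y)" by (simp add: xy)
    then have "(x, y + 1) \<in> M"
      using v(1) Dv by (auto simp: M_def T_def xy)
    from v(2)[OF this] show False by (simp add: xy)
  qed
  ultimately show False
    using le[of "(x + 1, y)"] le[of "(x + -1, y)"] le[of "(x, y + -1)"]
    by (simp add: neighbour_sum_def xy)
qed

text \<open>Reversing the sum gives the first \<open>m\<close> positive squares; the induction rests
  on \<open>(m + 1)^3 - m^3 \<le> 3 * (m + 1)^2\<close>.\<close>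

lemma cube_le_sum_squares: "real m ^ 3 \<le> 3 * (\<Sum>i<m. (real m - real i)\<^sup>2)"
proof -
  have "(\<Sum>i<m. (real m - real i)\<^sup>2) = (\<Sum>i<m. (real (Suc i))\<^sup>2)"
    by (subst sum.nat_diff_reindex[symmetric]) (auto intro!: sum.cong simp: of_nat_diff)
  moreover have "real m ^ 3 \<le> 3 * (\<Sum>i<m. (real (Suc i))\<^sup>2)"
    by (induction m) (auto simp: power2_eq_square power3_eq_cube algebra_simps)
  ultimately show ?thesis by simp
qed

section \<open>The stationary harmonic measure of the segment as a row sum\<close>

lemma harmonic_measure_from_segment:
  assumes "n < N"
  shows "harmonic_measure_from (segment n) N x = (\<Sum>\<^sub>\<infinity>k. hitting_prob (k, int N) (segment n \<union> level 0) x)"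
proof -
  have "bij_betw (\<lambda>k. (k, int N)) UNIV (level N - segment n)"
    using assms by (intro bij_betw_byWitness[where f' = fst]) (auto simp: level_def segment_def)
  from infsum_reindex_bij_betw[OF this, of "\<lambda>z. hitting_prob z (segment n \<union> level 0) x"]
  show ?thesis by (simp add: harmonic_measure_from_def)
qed

lemma in_segmentE:
  assumes "x \<in> segment n"
  obtains j where "j \<le> n" "x = (0, int j)"
proof (rule that[of "nat (snd x)"])
qed (use assms in \<open>auto simp: segment_def\<close>)

text \<open>Harmonicity at heights above \<open>n\<close> makes \<open>F\<close> affine from height
  \<open>n\<close> itself. Unlike \<open>harmonic_measure_from\<close> at \<open>N = n\<close>, this
  row sum includes the start at the tip \<open>(0, n)\<close>.\<close>

lemma stationary_harmonic_measure_segment: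
  assumes "x \<in> segment n"
  shows "stationary_harmonic_measure (segment n) x =
    (\<Sum>\<^sub>\<infinity>k. hitting_prob (k, int n) (segment n \<union> level 0) x)"
proof -
  let ?A = "segment n \<union> level 0"
  define F where "F m = (\<Sum>\<^sub>\<infinity>k. hitting_prob (k, int m) ?A x)" for m
  obtain j where j: "j \<le> n" "x = (0, int j)"
    using assms by (rule in_segmentE)
  have summable: "(\<lambda>k. hitting_prob (k, int m) ?A x) summable_on UNIV" for m
    unfolding j by (rule summable_on_hitting_prob_row) simp
  have "F (n + m) + F (n + Suc (Suc m)) = 2 * F (n + Suc m)" for m
  proof -
    have "neighbour_sum (\<lambda>z. hitting_prob z ?A x) k (int (Suc (n + m))) = 4 * hitting_prob (k, int (Suc (n + m))) ?A x" for k
      by (rule neighbour_sum_hitting_prob) (auto simp: segment_def level_def)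
    with has_sum_neighbour_sum[of "\<lambda>z. hitting_prob z ?A x" "n + m", OF summable]
    have "((\<lambda>k. 4 * hitting_prob (k, int (Suc (n + m))) ?A x) has_sum
        2 * F (Suc (n + m)) + F (Suc (Suc (n + m))) + F (n + m)) UNIV"
      by (simp only: F_def)
    moreover have "((\<lambda>k. 4 * hitting_prob (k, int (Suc (n + m))) ?A x) has_sum 4 * F (Suc (n + m))) UNIV"
      unfolding F_def by (intro has_sum_cmult_right has_sum_infsum summable)
    ultimately have "2 * F (Suc (n + m)) + F (Suc (Suc (n + m))) + F (n + m) = 4 * F (Suc (n + m))"
      by (rule has_sum_unique)
    then show ?thesis by simp
  qed
  moreover have "0 \<le> F m" for m
    unfolding F_def by (intro infsum_nonneg hitting_prob_nonneg)
  moreover have "F m \<le> 1 + 4 * real j" for m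
    using infsum_hitting_prob_row_le[of ?A m 0 j] by (simp add: F_def j)
  ultimately have "F (n + m) = F n" for m
    using affine_bounded_imp_const[of "\<lambda>m. F (n + m)" "1 + 4 * real j" m] by simp
  then have "F N = F n" if "n < N" for N
    using that less_imp_add_positive by blast
  then have "eventually (\<lambda>N. harmonic_measure_from (segment n) N x = F n) sequentially"
    by (intro eventually_mono[OF eventually_gt_at_top[of n]]) (simp add: harmonic_measure_from_segment F_def)
  then have "(\<lambda>N. harmonic_measure_from (segment n) N x) \<longlonglongrightarrow> F n"
    by (rule tendsto_eventually)
  then show ?thesis
    by (simp add: stationary_harmonic_measure_def F_def limI)
qed

lemma finite_segment: "finite (segment n)"
proof (rule finite_subset)
  show "segment n \<subseteq> {0} \<times> {0..int n}" by (auto simp: segment_def)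
qed simp

section \<open>The probability of hitting the segment and its row sums\<close>

definition segment_hitting_prob :: "nat \<Rightarrow> site \<Rightarrow> real" where
  "segment_hitting_prob n z = (\<Sum>x\<in>segment n. hitting_prob z (segment n \<union> level 0) x)"

lemma segment_hitting_prob_nonneg: "0 \<le> segment_hitting_prob n z"
  unfolding segment_hitting_prob_def by (intro sum_nonneg hitting_prob_nonneg)

lemma segment_hitting_prob_le_1: "segment_hitting_prob n z \<le> 1"
  unfolding segment_hitting_prob_def by (intro sum_hitting_prob_le_1 finite_segment)

lemma segment_hitting_prob_eq_1: "z \<in> segment n \<Longrightarrow> segment_hitting_prob n z = 1"
  by (simp add: segment_hitting_prob_def hitting_prob_start finite_segment of_bool_def)

text \<open>On the segment the value 1 is maximal; elsewhere above level 0 the first-step identity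
  gives equality.\<close>

lemma neighbour_sum_segment_hitting_prob_le:
  assumes "0 < y"
  shows "neighbour_sum (segment_hitting_prob n) x y \<le> 4 * segment_hitting_prob n (x, y)"
proof (cases "(x, y) \<in> segment n")
  case True
  show ?thesis
    using segment_hitting_prob_le_1[of n "(x + 1, y)"] segment_hitting_prob_le_1[of n "(x + -1, y)"]
      segment_hitting_prob_le_1[of n "(x, y + 1)"] segment_hitting_prob_le_1[of n "(x, y + -1)"]
    by (simp add: neighbour_sum_def segment_hitting_prob_eq_1[OF True])
next
  case False
  with assms have "(x, y) \<notin> segment n \<union> level 0"
    by (auto simp: level_def)
  note * = neighbour_sum_hitting_prob[OF this]
  have "neighbour_sum (segment_hitting_prob n) x y =
      (\<Sum>w\<in>segment n. neighbour_sum (\<lambda>z. hitting_prob z (segment n \<union> level 0) w) x y)"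
    by (simp only: neighbour_sum_def segment_hitting_prob_def sum.distrib)
  also have "\<dots> = 4 * segment_hitting_prob n (x, y)"
    unfolding * by (simp only: segment_hitting_prob_def sum_distrib_left)
  finally show ?thesis by simp
qed

lemma has_sum_finite_sum:
  fixes f :: "'b \<Rightarrow> 'a \<Rightarrow> 'c :: topological_comm_monoid_add"
  assumes "finite I" "\<And>i. i \<in> I \<Longrightarrow> (f i has_sum s i) A"
  shows "((\<lambda>x. \<Sum>i\<in>I. f i x) has_sum (\<Sum>i\<in>I. s i)) A"
  using assms by (induction I rule: finite_induct) (auto intro: has_sum_add)

lemma segment_hitting_prob_row_has_sum:
  "((\<lambda>k. segment_hitting_prob n (k, int m)) has_sum
    (\<Sum>x\<in>segment n. \<Sum>\<^sub>\<infinity>k. hitting_prob (k, int m) (segment n \<union> level 0) x)) UNIV"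
  unfolding segment_hitting_prob_def
proof (intro has_sum_finite_sum finite_segment has_sum_infsum)
  fix x
  assume "x \<in> segment n"
  then show "(\<lambda>k. hitting_prob (k, int m) (segment n \<union> level 0) x) summable_on UNIV"
    by (elim in_segmentE) (auto intro!: summable_on_hitting_prob_row)
qed

text \<open>This reduces the theorem to bounding hitting probabilities from below at finitely many
  sites of one row.\<close>

lemma segment_row_sum_le_total_harmonic_measure:
  assumes "m \<le> n" and "finite K"
  shows "(\<Sum>k\<in>K. segment_hitting_prob n (k, int m)) \<le> total_harmonic_measure (segment n)"
proof -
  define G where "G m = (\<Sum>\<^sub>\<infinity>k. segment_hitting_prob n (k, int m))" for m
  note summable = has_sum_imp_summable[OF segment_hitting_prob_row_has_sum]
  note nonneg = segment_hitting_prob_nonneg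
  have "total_harmonic_measure (segment n) = G n"
    using infsumI[OF segment_hitting_prob_row_has_sum, of n n]
    by (simp add: total_harmonic_measure_def stationary_harmonic_measure_segment G_def)
  moreover have "mono G"
  proof (rule concave_nonneg_imp_mono)
    fix m
    have "2 * G (Suc m) + G (Suc (Suc m)) + G m \<le> 4 * G (Suc m)"
      unfolding G_def
      by (rule has_sum_mono[OF has_sum_neighbour_sum[OF summable] has_sum_cmult_right[OF has_sum_infsum[OF summable]]])
        (simp add: neighbour_sum_segment_hitting_prob_le)
    then show "G m + G (Suc (Suc m)) \<le> 2 * G (Suc m)" by simp
  qed (simp add: G_def infsum_nonneg nonneg)
  moreover have "(\<Sum>k\<in>K. segment_hitting_prob n (k, int m)) \<le> G m"
    unfolding G_def using assms by (intro finite_sum_le_infsum summable nonneg) auto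
  ultimately show ?thesis
    using monoD[of G m n] assms by simp
qed

section \<open>The linear lower bound\<close>

text \<open>The condition \<open>2 * m \<le> n\<close> puts the part of the axis where the tent is
  positive inside the segment. There the hitting probability is 1 and the tent is at most
  \<open>m^2\<close>, whence the scaling. At height \<open>m\<close> the two tent factors
  coincide.\<close>

lemma segment_hitting_prob_ge:
  assumes "2 * m \<le> n" "i < m"
  shows "(real m - real i)\<^sup>2 \<le> (real m)\<^sup>2 * segment_hitting_prob n (int i, int m)"
proof -
  have "real_of_int (tent (int m) (int i, int m)) \<le> (real m)\<^sup>2 * segment_hitting_prob n (int i, int m)"
  proof (rule tent_le_superharmonic)
    fix z
    show "0 \<le> (real m)\<^sup>2 * segment_hitting_prob n z"
      by (simp add: segment_hitting_prob_nonneg)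
  next
    fix y
    assume y: "0 < y" "y < 2 * int m"
    then have "(0, y) \<in> segment n"
      using assms by (auto simp: segment_def)
    moreover have "tent (int m) (0, y) = (int m)\<^sup>2 - (int m - y)\<^sup>2"
      using y by (simp add: tent_def power2_eq_square algebra_simps)
    ultimately show "real_of_int (tent (int m) (0, y)) \<le> (real m)\<^sup>2 * segment_hitting_prob n (0, y)"
      by (simp add: segment_hitting_prob_eq_1)
  next
    fix x y :: int
    assume "0 < y"
    from neighbour_sum_segment_hitting_prob_le[OF this, of n x]
    have "(real m)\<^sup>2 * neighbour_sum (segment_hitting_prob n) x y
        \<le> (real m)\<^sup>2 * (4 * segment_hitting_prob n (x, y))"
      by (rule mult_left_mono) simp
    then show "neighbour_sum (\<lambda>z. (real m)\<^sup>2 * segment_hitting_prob n z) x y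
        \<le> 4 * ((real m)\<^sup>2 * segment_hitting_prob n (x, y))"
      by (simp add: neighbour_sum_def algebra_simps)
  qed
  moreover have "real_of_int (tent (int m) (int i, int m)) = (real m - real i)\<^sup>2"
    using assms by (simp add: tent_def power2_eq_square)
  ultimately show ?thesis by simp
qed

lemma total_harmonic_measure_segment_ge_third:
  assumes "2 * m \<le> n"
  shows "real m / 3 \<le> total_harmonic_measure (segment n)"
proof (cases "m = 0")
  case True
  then show ?thesis
    \<comment> \<open>The empty sum gives nonnegativity of the total measure.\<close>
    using segment_row_sum_le_total_harmonic_measure[of 0 n "{}"] by simp
next
  case False
  have "real m ^ 3 \<le> 3 * (\<Sum>i<m. (real m - real i)\<^sup>2)"
    by (rule cube_le_sum_squares)
  also have "\<dots> \<le> 3 * (\<Sum>i<m. (real m)\<^sup>2 * segment_hitting_prob n (int i, int m))"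
    using segment_hitting_prob_ge[OF assms] by (intro mult_left_mono sum_mono) auto
  also have "\<dots> = (real m)\<^sup>2 * (3 * (\<Sum>k\<in>int ` {..<m}. segment_hitting_prob n (k, int m)))"
    by (simp add: sum.reindex sum_distrib_left algebra_simps)
  also have "\<dots> \<le> (real m)\<^sup>2 * (3 * total_harmonic_measure (segment n))"
    using assms by (intro mult_left_mono segment_row_sum_le_total_harmonic_measure) auto
  finally show ?thesis
    using False by (simp add: power3_eq_cube power2_eq_square)
qed

theorem theorem4:
  "\<exists>c::real. c > 0 \<and> (\<forall>n::nat. total_harmonic_measure (segment n) \<ge> c * real n)"
proof (intro exI conjI allI)
  fix n :: nat
  \<comment> \<open>One factor 1/3 comes from the cube bound, the other from
    \<open>n \<le> 3 * (n div 2)\<close>, which is sharp at \<open>n = 3\<close> and fails only at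
    \<open>n = 1\<close>.\<close>
  show "1 / 9 * real n \<le> total_harmonic_measure (segment n)"
  proof (cases "n = 1")
    case True
    \<comment> \<open>Here \<open>n div 2 = 0\<close> and the general bound is void; the start at
      the tip alone contributes 1.\<close>
    have "segment_hitting_prob n (0, int n) = 1"
      by (rule segment_hitting_prob_eq_1) (simp add: segment_def)
    with segment_row_sum_le_total_harmonic_measure[of n n "{0}"] True show ?thesis by simp
  next
    case False
    then have "n \<le> 3 * (n div 2)" by presburger
    then have "real n \<le> 3 * real (n div 2)" by linarith
    with total_harmonic_measure_segment_ge_third[of "n div 2" n] show ?thesis by simp
  qed
qed simp

end
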